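(* Let $N = (2,2,m,n,2,2)$ and let $G = G(k,m,n)$ be the spatial graph with six ordered edges $a,b,c,d,e,f$ described in the context (so $a,b,e,f$ are labeled $2$, $c$ is labeled $m$, and $d$ is labeled $n$). Then the fundamental $N$-quandle of $G$ satisfies $$\vert Q_N(G)\vert = 4kmn + 2km + 2kn.$$
   Context: A quandle is a set $Q$ with binary operations $\rhd,\rhd^{-1}$ such that $x\rhd x=x$; $(x\rhd y)\rhd^{-1}y = x = (x\rhd^{-1}y)\rhd y$; and $(x\rhd y)\rhd z=(x\rhd z)\rhd(y\rhd z)$. Write $x^y = x\rhd y$, $x^{\bar y}=x\rhd^{-1}y$, and $x^{yz}=(x^y)^z$; thus $x^w$ makes sense for any word $w$ in elements and their formal inverses, and $y^j$ in an exponent means $y$ repeated $j$ times ($\bar y$ repeated $|j|$ times if $j<0$). Fundamental quandle. For an oriented spatial graph $G\subset \mathbb{S}^3$ with a regular diagram, the fundamental quandle $Q(G)$ is generated by the arcs of the diagram, with a relation $x_i = x_k^{x_j}$ at each crossing ($x_j$ the over-arc, $x_k$ and $x_i$ the under-arcs on its left and right respectively) and, at each vertex with incident arcs $a_1,\dots,a_r$ listed in (counterclockwise) cyclic order, the relations $((x\rhd^{\varepsilon_1}a_1)\rhd^{\varepsilon_2}a_2)\cdots\rhd^{\varepsilon_r}a_r = x$ for all $x$, where $\varepsilon_i=1$ if $a_i$ is directed into the vertex and $-1$ if out of it. If the ordered edges $e_1,\dots,e_s$ of $G$ are labeled by natural numbers $N=(n_1,\dots,n_s)$, the fundamental $N$-quandle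 $Q_N(G)$ is the quotient of $Q(G)$ by the relations $x^{y^{n_i}}=x$ for all $x$, whenever $y$ is an arc of edge $e_i$. The graph $G(k,m,n)$. From left to right place a vertical edge (strut) $c$, labeled $m$, a horizontal block of $k$ right-handed half-twists on two strands, and a vertical edge (strut) $d$, labeled $n$. The two strand ends on the right of the block are joined to the top and bottom endpoints of $d$; the arcs there are called $a$ (top) and $b$ (bottom), and the edges containing them are called $a$ and $b$. The two strand ends on the left of the block are joined to the top and bottom endpoints of $c$. An edge $e$, passing over the top of the picture without crossings, joins the top endpoints of $c$ and $d$; an edge $f$, passing under the bottom without crossings, joins the bottom endpoints of $c$ and $d$. (The underlying graph is $K_4$ if $k$ is odd and a double handcuff graph if $k$ is even.) With $N=(2,2,m,n,2,2)$, eliminating the generators inside the twist block gives the presentation $$Q_N(G) = \langle a,b,c,d,e,f \mid x^{a^2}=x^{b^2}=x^{e^2}=x^{f^2}=x^{c^m}=x^{d^n}=x,\ x^{dea}=x,\ x^{bdf}=x,\ x^{c(ab)^kae}=x,\ x^{fc(ab)^{k-1}a}=x\rangle,$$ where each relation is imposed for every element $x$ of the quandle (equivalently, for every generator $x$). *)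

theory Defs
  imports Main
begin

section \<open>Quandles\<close>

record 'a quandle =
  carrier :: "'a set"
  rhd :: "'a \<Rightarrow> 'a \<Rightarrow> 'a"
  rhd_inv :: "'a \<Rightarrow> 'a \<Rightarrow> 'a"

locale quandle =
  fixes Q :: "('a, 'b) quandle_scheme"
  assumes rhd_closed: "x \<in> carrier Q \<Longrightarrow> y \<in> carrier Q \<Longrightarrow> rhd Q x y \<in> carrier Q"
    and rhd_inv_closed: "x \<in> carrier Q \<Longrightarrow> y \<in> carrier Q \<Longrightarrow> rhd_inv Q x y \<in> carrier Q"
    and idem: "x \<in> carrier Q \<Longrightarrow> rhd Q x x = x"
    and rhd_rhd_inv:
      "x \<in> carrier Q \<Longrightarrow> y \<in> carrier Q \<Longrightarrow> rhd_inv Q (rhd Q x y) y = x"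
    and rhd_inv_rhd:
      "x \<in> carrier Q \<Longrightarrow> y \<in> carrier Q \<Longrightarrow> rhd Q (rhd_inv Q x y) y = x"
    and distrib:
      "x \<in> carrier Q \<Longrightarrow> y \<in> carrier Q \<Longrightarrow> z \<in> carrier Q \<Longrightarrow>
        rhd Q (rhd Q x y) z = rhd Q (rhd Q x z) (rhd Q y z)"


section \<open>Quandles given by generators and relations\<close>

datatype 'g qterm =
    Gen 'g
  | Rhd "'g qterm" "'g qterm"
  | RhdInv "'g qterm" "'g qterm"

definition qterms :: "'g set \<Rightarrow> 'g qterm set" where
  "qterms A = {t. set_qterm t \<subseteq> A}"

text \<open>The least congruence on the terms over the generators \<open>A\<close> that contains the relations
  \<open>R\<close> and all instances of the quandle axioms.\<close>

inductive qeq :: "'g set \<Rightarrow> ('g qterm \<times> 'g qterm) set \<Rightarrow> 'g qterm \<Rightarrow> 'g qterm \<Rightarrow> bool"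
  for A R where
  rel: "(s, t) \<in> R \<Longrightarrow> s \<in> qterms A \<Longrightarrow> t \<in> qterms A \<Longrightarrow> qeq A R s t"
| idem: "x \<in> qterms A \<Longrightarrow> qeq A R (Rhd x x) x"
| rhd_rhd_inv: "x \<in> qterms A \<Longrightarrow> y \<in> qterms A \<Longrightarrow> qeq A R (RhdInv (Rhd x y) y) x"
| rhd_inv_rhd: "x \<in> qterms A \<Longrightarrow> y \<in> qterms A \<Longrightarrow> qeq A R (Rhd (RhdInv x y) y) x"
| distrib: "x \<in> qterms A \<Longrightarrow> y \<in> qterms A \<Longrightarrow> z \<in> qterms A \<Longrightarrow>
    qeq A R (Rhd (Rhd x y) z) (Rhd (Rhd x z) (Rhd y z))"
| refl: "x \<in> qterms A \<Longrightarrow> qeq A R x x"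
| sym: "qeq A R x y \<Longrightarrow> qeq A R y x"
| trans: "qeq A R x y \<Longrightarrow> qeq A R y z \<Longrightarrow> qeq A R x z"
| cong_rhd: "qeq A R x x' \<Longrightarrow> qeq A R y y' \<Longrightarrow> qeq A R (Rhd x y) (Rhd x' y')"
| cong_rhd_inv: "qeq A R x x' \<Longrightarrow> qeq A R y y' \<Longrightarrow> qeq A R (RhdInv x y) (RhdInv x' y')"

definition presented_quandle ::
    "'g set \<Rightarrow> ('g qterm \<times> 'g qterm) set \<Rightarrow> 'g qterm set quandle" where
  "presented_quandle A R =
    \<lparr> carrier = qterms A // {(s, t). qeq A R s t},
      rhd = (\<lambda>X Y. {t. \<exists>x\<in>X. \<exists>y\<in>Y. qeq A R (Rhd x y) t}),
      rhd_inv = (\<lambda>X Y. {t. \<exists>x\<in>X. \<exists>y\<in>Y. qeq A R (RhdInv x y) t}) \<rparr>"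

lemma qterms_simps [simp]:
  "Gen g \<in> qterms A \<longleftrightarrow> g \<in> A"
  "Rhd x y \<in> qterms A \<longleftrightarrow> x \<in> qterms A \<and> y \<in> qterms A"
  "RhdInv x y \<in> qterms A \<longleftrightarrow> x \<in> qterms A \<and> y \<in> qterms A"
  by (auto simp: qterms_def)

lemma qeq_qterms: "qeq A R s t \<Longrightarrow> s \<in> qterms A \<and> t \<in> qterms A"
  by (induction rule: qeq.induct) auto

lemma equiv_qeq: "equiv (qterms A) {(s, t). qeq A R s t}"
  by (rule equivI)
    (auto simp: refl_on_def sym_def trans_def dest: qeq_qterms intro: qeq.refl qeq.sym qeq.trans)

definition qclass :: "'g set \<Rightarrow> ('g qterm \<times> 'g qterm) set \<Rightarrow> 'g qterm \<Rightarrow> 'g qterm set" where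
  "qclass A R x = {t. qeq A R x t}"

lemma qclass_eq_iff: "x \<in> qterms A \<Longrightarrow> qclass A R x = qclass A R y \<longleftrightarrow> qeq A R x y"
  unfolding qclass_def by (blast intro: qeq.refl qeq.sym qeq.trans)

lemma carrier_presented: "carrier (presented_quandle A R) = qclass A R ` qterms A"
  by (auto simp: presented_quandle_def quotient_def qclass_def)

lemma rhd_presented:
  assumes "x \<in> qterms A" "y \<in> qterms A"
  shows "rhd (presented_quandle A R) (qclass A R x) (qclass A R y) = qclass A R (Rhd x y)"
  using assms unfolding presented_quandle_def qclass_def
  by (auto intro: qeq.refl) (meson qeq.cong_rhd qeq.trans)

lemma rhd_inv_presented:
  assumes "x \<in> qterms A" "y \<in> qterms A"
  shows "rhd_inv (presented_quandle A R) (qclass A R x) (qclass A R y) = qclass A R (RhdInv x y)"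
  using assms unfolding presented_quandle_def qclass_def
  by (auto intro: qeq.refl) (meson qeq.cong_rhd_inv qeq.trans)

lemma quandle_presented: "quandle (presented_quandle A R)"
  by unfold_locales
    (auto simp: carrier_presented rhd_presented rhd_inv_presented qclass_eq_iff
        imageI [of _ _ "qclass A R"]
      intro: qeq.idem qeq.rhd_rhd_inv qeq.rhd_inv_rhd qeq.distrib
      del: equalityI subsetI)

text \<open>A letter \<open>(y, True)\<close> of a word stands for \<open>y\<close> and a letter \<open>(y, False)\<close> for its formal
  inverse; words act from left to right.\<close>

definition act :: "'g qterm \<Rightarrow> ('g \<times> bool) list \<Rightarrow> 'g qterm" where
  "act = foldl (\<lambda>x (y, pos). if pos then Rhd x (Gen y) else RhdInv x (Gen y))"


section \<open>Diagrams of oriented spatial graphs and their fundamental quandles\<close>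

record 'g crossing =
  over :: 'g
  under_left :: 'g
  under_right :: 'g

text \<open>A vertex is the list of its incident arcs in counterclockwise order; an arc is paired with
  \<open>True\<close> if it is directed into the vertex and with \<open>False\<close> if it is directed out of it.
  An edge is the set of the arcs that form it.\<close>

record 'g diagram =
  arcs :: "'g set"
  crossings :: "'g crossing set"
  vertices :: "('g \<times> bool) list set"
  edges :: "'g set list"

definition crossing_rels :: "'g diagram \<Rightarrow> ('g qterm \<times> 'g qterm) set" where
  "crossing_rels D =
    {(Gen (under_right \<chi>), Rhd (Gen (under_left \<chi>)) (Gen (over \<chi>))) | \<chi>. \<chi> \<in> crossings D}"

definition vertex_rels :: "'g diagram \<Rightarrow> ('g qterm \<times> 'g qterm) set" where
  "vertex_rels D = {(act x v, x) | x v. x \<in> qterms (arcs D) \<and> v \<in> vertices D}"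

definition fundamental_quandle :: "'g diagram \<Rightarrow> 'g qterm set quandle" where
  "fundamental_quandle D = presented_quandle (arcs D) (crossing_rels D \<union> vertex_rels D)"

definition label_rels :: "'g diagram \<Rightarrow> nat list \<Rightarrow> ('g qterm \<times> 'g qterm) set" where
  "label_rels D N =
    {(act x (replicate (N ! i) (y, True)), x) | x y i.
      x \<in> qterms (arcs D) \<and> i < length (edges D) \<and> y \<in> edges D ! i}"

text \<open>The quotient of the fundamental quandle by the label relations is the quandle
  on the same generators with the label relations added.\<close>

definition fundamental_N_quandle :: "'g diagram \<Rightarrow> nat list \<Rightarrow> 'g qterm set quandle" where
  "fundamental_N_quandle D N =
    presented_quandle (arcs D) (crossing_rels D \<union> vertex_rels D \<union> label_rels D N)"


section \<open>The graph with a twisted pair of strands between two struts\<close>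

text \<open>The arcs of the two strands of the twist block are numbered from right to left:
  \<open>Strand 1\<close> and \<open>Strand 0\<close> end at the top and the bottom of the strut \<open>D\<close>, and
  \<open>Strand (k + 1)\<close> and \<open>Strand k\<close> end at the top and the bottom of the strut \<open>C\<close>.
  At the \<open>i\<close>-th crossing from the right, \<open>Strand i\<close> runs from the bottom left to the top
  right and passes over, \<open>Strand (i - 1)\<close> comes in from the bottom right, and
  \<open>Strand (i + 1)\<close> from the top left. Arcs of equal parity belong to the same edge.
  The arc \<open>E\<close> joins the tops of the struts \<open>C\<close> (left) and \<open>D\<close> (right), \<open>F\<close> their bottoms.
  The struts are directed upwards, the other four edges from the end at \<open>C\<close> to the end at
  \<open>D\<close>.\<close>

datatype arc = Strand nat | C | D | E | F

definition strut_twist_graph :: "nat \<Rightarrow> arc diagram" where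
  "strut_twist_graph k =
    \<lparr> arcs = Strand ` {..k + 1} \<union> {C, D, E, F},
      crossings =
        {\<lparr>over = Strand i, under_left = Strand (i + 1), under_right = Strand (i - 1)\<rparr> | i.
          1 \<le> i \<and> i \<le> k},
      vertices =
        { [(D, True), (E, True), (Strand 1, True)],
          [(Strand 0, True), (F, True), (D, False)],
          [(C, True), (Strand (k + 1), False), (E, False)],
          [(Strand k, False), (C, False), (F, False)] },
      edges =
        [ {Strand i | i. i \<le> k + 1 \<and> odd i},
          {Strand i | i. i \<le> k + 1 \<and> even i},
          {C}, {D}, {E}, {F} ] \<rparr>"

end

theory Submission
  imports Defs "HOL-Library.Product_Plus"
begin

text \<open>Write \<open>a\<close>, \<open>b\<close>, \<dots> also for the right translations by the generators and put \<open>r = a b\<close>. The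
  vertex relations give \<open>e = a d\<close> and \<open>f = b d\<close>; as \<open>a\<close>, \<open>b\<close>, \<open>e\<close>, \<open>f\<close> are involutions, \<open>a\<close> and \<open>b\<close>
  invert \<open>d\<close>, so \<open>r\<close> commutes with \<open>d\<close>, \<open>a\<close> inverts both, and \<open>c = d\<^sup>-\<^sup>1 r\<^sup>-\<^sup>k\<close>. Thus the translations
  form the generalised dihedral group of the quotient of \<open>\<int>\<^sup>2\<close>, with basis \<open>d\<close>, \<open>r\<close>, by the lattice
  spanned by \<open>(n, 0)\<close> and \<open>(m, k m)\<close>; its order is \<open>2 k m n\<close>. Every edge contributes one orbit, and the
  stabiliser of a generator is the cyclic group generated by its own translation, of order 2 for
  \<open>a\<close>, \<open>b\<close>, \<open>e\<close>, \<open>f\<close>, of order \<open>m\<close> for \<open>c\<close> and of order \<open>n\<close> for \<open>d\<close>. That these stabilisers are not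
  larger is seen by interpreting all terms in the quandle of cosets.\<close>

text \<open>Both images index the same partition of \<open>A\<close>. It serves to compare the class
  map on terms with the normal form map.\<close>

lemma card_image_cong:
  assumes "\<And>x y. x \<in> A \<Longrightarrow> y \<in> A \<Longrightarrow> f x = f y \<longleftrightarrow> g x = g y"
  shows "card (f ` A) = card (g ` A)"
proof -
  let ?h = "\<lambda>z. f (inv_into A g z)"
  have h: "?h (g x) = f x" if "x \<in> A" for x
    using that assms [of "inv_into A g (g x)" x] by (simp add: inv_into_into f_inv_into_f)
  then have "inj_on ?h (g ` A)"
    using assms by (auto simp: inj_on_def)
  moreover have "?h ` g ` A = f ` A"
    using h by (auto simp: image_image)
  ultimately show ?thesis
    by (metis card_image)
qed


section \<open>Translations of a quandle\<close>

text \<open>Outside the carrier the translations are extended by the identity, so that identities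
  between them are equations of functions.\<close>

context quandle
begin

definition trl :: "'a \<Rightarrow> 'a \<Rightarrow> 'a" where
  "trl y x = (if x \<in> carrier Q then rhd Q x y else x)"

definition trl_inv :: "'a \<Rightarrow> 'a \<Rightarrow> 'a" where
  "trl_inv y x = (if x \<in> carrier Q then rhd_inv Q x y else x)"

lemma trl_comp_inv [simp]: "y \<in> carrier Q \<Longrightarrow> trl y \<circ> trl_inv y = id"
  by (auto simp: fun_eq_iff trl_def trl_inv_def rhd_inv_closed rhd_inv_rhd)

lemma trl_inv_comp [simp]: "y \<in> carrier Q \<Longrightarrow> trl_inv y \<circ> trl y = id"
  by (auto simp: fun_eq_iff trl_def trl_inv_def rhd_closed rhd_rhd_inv)

lemma trl_self: "y \<in> carrier Q \<Longrightarrow> trl y y = y"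
  by (simp add: trl_def idem)

lemma trl_rhd:
  assumes "y \<in> carrier Q" "z \<in> carrier Q"
  shows "trl (rhd Q y z) = trl z \<circ> trl y \<circ> trl_inv z"
proof
  fix x show "trl (rhd Q y z) x = (trl z \<circ> trl y \<circ> trl_inv z) x"
    \<comment> \<open>Self-distributivity, applied to the preimage of \<open>x\<close> under the
      translation by \<open>z\<close>.\<close>
    using assms distrib [of "rhd_inv Q x z" y z]
    by (simp add: trl_def trl_inv_def rhd_inv_closed rhd_closed rhd_inv_rhd)
qed

lemma trl_rhd_inv:
  assumes "y \<in> carrier Q" "z \<in> carrier Q"
  shows "trl (rhd_inv Q y z) = trl_inv z \<circ> trl y \<circ> trl z"
proof -
  have "trl y = trl z \<circ> trl (rhd_inv Q y z) \<circ> trl_inv z"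
    using trl_rhd [of "rhd_inv Q y z" z] assms by (simp add: rhd_inv_closed rhd_inv_rhd)
  then have "trl_inv z \<circ> trl y \<circ> trl z
      = (trl_inv z \<circ> trl z) \<circ> trl (rhd_inv Q y z) \<circ> (trl_inv z \<circ> trl z)"
    by (simp only: comp_assoc)
  then show ?thesis
    using assms by simp
qed

end

section \<open>Words acting on the classes of terms\<close>

lemma act_simps [simp]:
  "act x [] = x"
  "act x ((y, True) # w) = act (Rhd x (Gen y)) w"
  "act x ((y, False) # w) = act (RhdInv x (Gen y)) w"
  by (simp_all add: act_def)

lemma act_qterms: "x \<in> qterms A \<Longrightarrow> fst ` set w \<subseteq> A \<Longrightarrow> act x w \<in> qterms A"
proof (induction w arbitrary: x)
  case (Cons l w)
  then show ?case by (cases l; cases "snd l") auto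
qed (simp add: act_def)

locale quandle_presentation =
  fixes A :: "'g set" and R :: "('g qterm \<times> 'g qterm) set"
begin

abbreviation "Q \<equiv> presented_quandle A R"
abbreviation "cls \<equiv> qclass A R"
abbreviation "gen y \<equiv> cls (Gen y)"

sublocale quandle Q
  by (rule quandle_presented)

lemma cls_closed [simp]: "x \<in> qterms A \<Longrightarrow> cls x \<in> carrier Q"
  by (simp add: carrier_presented)

lemma trl_cls: "x \<in> qterms A \<Longrightarrow> y \<in> qterms A \<Longrightarrow> trl (cls y) (cls x) = cls (Rhd x y)"
  by (simp add: trl_def rhd_presented)

lemma trl_inv_cls:
  "x \<in> qterms A \<Longrightarrow> y \<in> qterms A \<Longrightarrow> trl_inv (cls y) (cls x) = cls (RhdInv x y)"
  by (simp add: trl_inv_def rhd_inv_presented)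

fun word_trl :: "('g \<times> bool) list \<Rightarrow> 'g qterm set \<Rightarrow> 'g qterm set" where
  "word_trl [] X = X"
| "word_trl ((y, True) # w) X = word_trl w (trl (gen y) X)"
| "word_trl ((y, False) # w) X = word_trl w (trl_inv (gen y) X)"

lemma cls_act:
  assumes "fst ` set w \<subseteq> A" "x \<in> qterms A"
  shows "cls (act x w) = word_trl w (cls x)"
  using assms by (induction w "cls x" arbitrary: x rule: word_trl.induct) (simp_all add: trl_cls trl_inv_cls)

text \<open>On the carrier, a relator imposed on every term fixes every class; elsewhere all letters
  act as the identity.\<close>

lemma word_trl_relator:
  assumes "fst ` set w \<subseteq> A" and "\<And>x. x \<in> qterms A \<Longrightarrow> (act x w, x) \<in> R"
  shows "word_trl w = id"
proof
  fix X show "word_trl w X = id X"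
  proof (cases "X \<in> carrier Q")
    case True
    then obtain x where x: "x \<in> qterms A" "X = cls x"
      by (auto simp: carrier_presented)
    with assms show ?thesis
      by (simp add: cls_act [symmetric] qclass_eq_iff act_qterms qeq.rel)
  next
    case False
    then show ?thesis
      by (induction w X rule: word_trl.induct) (auto simp: trl_def trl_inv_def)
  qed
qed

end


section \<open>The generalised dihedral group of the plane lattice\<close>

text \<open>The pair \<open>(\<delta>, u)\<close> stands for the product of the \<open>\<delta>\<close>-th power of a fixed reflection and
  the translation by \<open>u\<close>.\<close>

type_synonym dih = "bool \<times> int \<times> int"

definition dmul :: "dih \<Rightarrow> dih \<Rightarrow> dih"  (infixl "\<cdot>" 70) where
  "g \<cdot> h = (fst g \<noteq> fst h, snd h + (if fst h then - snd g else snd g))"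

definition dinv :: "dih \<Rightarrow> dih" where
  "dinv g = (fst g, if fst g then snd g else - snd g)"

lemma dmul_assoc: "g \<cdot> h \<cdot> p = g \<cdot> (h \<cdot> p)"
  by (auto simp: dmul_def algebra_simps)

lemma dmul_simps [simp]:
  "(False, 0) \<cdot> g = g" "g \<cdot> (False, 0) = g"
  "g \<cdot> dinv g = (False, 0)" "dinv g \<cdot> g = (False, 0)" "dinv (dinv g) = g"
  "dinv (g \<cdot> h) = dinv h \<cdot> dinv g"
  by (auto simp: dmul_def dinv_def prod_eq_iff)

lemma dmul_cancel [simp]: "g \<cdot> (dinv g \<cdot> h) = h" "dinv g \<cdot> (g \<cdot> h) = h"
  by (simp_all flip: dmul_assoc)

section \<open>Integer powers of a map with a given inverse\<close>

definition zpow :: "('a \<Rightarrow> 'a) \<Rightarrow> ('a \<Rightarrow> 'a) \<Rightarrow> int \<Rightarrow> 'a \<Rightarrow> 'a" where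
  "zpow f f' i = (if 0 \<le> i then f ^^ nat i else f' ^^ nat (- i))"

lemma zpow_simps [simp]: "zpow f f' 0 = id" "zpow f f' 1 = f" "zpow f f' (- 1) = f'"
  by (simp_all add: zpow_def)

lemma zpow_uminus: "zpow f f' (- i) = zpow f' f i"
  by (simp add: zpow_def)

text \<open>Covers both commuting maps (\<open>g = f\<close>) and maps inverted by \<open>h\<close>
  (\<open>g = f'\<close>).\<close>

lemma zpow_intertwine:
  assumes "h \<circ> f = g \<circ> h" "h \<circ> f' = g' \<circ> h"
  shows "h \<circ> zpow f f' i = zpow g g' i \<circ> h"
proof -
  have "h \<circ> p ^^ j = q ^^ j \<circ> h" if "h \<circ> p = q \<circ> h" for p q and j :: nat
  proof (induction j)
    case (Suc j)
    have "h \<circ> p ^^ Suc j = (h \<circ> p) \<circ> p ^^ j" by (simp add: comp_assoc)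
    also have "\<dots> = q \<circ> (h \<circ> p ^^ j)" by (simp only: that comp_assoc)
    also have "\<dots> = q ^^ Suc j \<circ> h" by (simp only: Suc.IH funpow.simps comp_assoc)
    finally show ?case .
  qed simp
  then show ?thesis
    using assms by (simp add: zpow_def)
qed

lemma zpow_add:
  assumes "f \<circ> f' = id" "f' \<circ> f = id"
  shows "zpow f f' (i + j) = zpow f f' i \<circ> zpow f f' j"
proof -
  have succ: "zpow g g' (i + 1) = g \<circ> zpow g g' i" if "g \<circ> g' = id" for g g' :: "'a \<Rightarrow> 'a" and i
  proof (cases "0 \<le> i")
    case True
    then show ?thesis by (simp add: zpow_def nat_add_distrib)
  next
    case False
    then have "nat (- i) = Suc (nat (- (i + 1)))" by simp
    with False that show ?thesis
      by (cases "i = - 1") (simp_all add: zpow_def flip: comp_assoc)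
  qed
  \<comment> \<open>The predecessor law is the successor law with \<open>f\<close> and
    \<open>f'\<close> exchanged.\<close>
  have pred: "zpow f f' (i - 1) = f' \<circ> zpow f f' i" for i
    using succ [of f' f "- i"] assms(2) by (simp add: zpow_uminus [of f' f, symmetric])
  show ?thesis
  proof (induction i rule: int_induct [where k = 0])
    case (step1 i)
    have "zpow f f' (i + 1 + j) = f \<circ> zpow f f' (i + j)"
      using succ [of f f' "i + j", OF assms(1)] by (simp add: add_ac)
    then show ?case using step1 succ [of f f' i] assms(1) by (simp add: comp_assoc)
  next
    case (step2 i)
    have "zpow f f' (i - 1 + j) = f' \<circ> zpow f f' (i + j)"
      using pred [of "i + j"] by (simp add: algebra_simps)
    then show ?case using step2 pred [of i] by (simp add: comp_assoc)
  qed simp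
qed

section \<open>Actions of the generalised dihedral group\<close>

locale dihedral_action =
  fixes A D D' B :: "'a \<Rightarrow> 'a"
  assumes AA: "A \<circ> A = id" and BB: "B \<circ> B = id"
    and DD': "D \<circ> D' = id" and D'D: "D' \<circ> D = id"
    and DA: "D \<circ> A = A \<circ> D'" and DB: "D \<circ> B = B \<circ> D'"
begin

text \<open>\<open>B \<circ> A\<close> applies \<open>A\<close> first, so it is the action of
  \<open>r = a b\<close>; likewise the reflection acts before the translation part.\<close>

definition dact :: "dih \<Rightarrow> 'a \<Rightarrow> 'a" where
  "dact = (\<lambda>(\<delta>, i, j). zpow D D' i \<circ> zpow (B \<circ> A) (A \<circ> B) j \<circ> (if \<delta> then A else id))"

lemma AA_left: "A \<circ> (A \<circ> f) = f" and BB_left: "B \<circ> (B \<circ> f) = f"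
  and DD'_left: "D \<circ> (D' \<circ> f) = f" and D'D_left: "D' \<circ> (D \<circ> f) = f"
  by (simp_all add: AA BB DD' D'D flip: comp_assoc)

lemma AD: "A \<circ> D = D' \<circ> A"
proof -
  have "D' \<circ> (D \<circ> A) \<circ> D = D' \<circ> (A \<circ> D') \<circ> D" by (simp only: DA)
  then show ?thesis by (simp add: comp_assoc D'D D'D_left)
qed

lemma BD: "B \<circ> D = D' \<circ> B"
proof -
  have "D' \<circ> (D \<circ> B) \<circ> D = D' \<circ> (B \<circ> D') \<circ> D" by (simp only: DB)
  then show ?thesis by (simp add: comp_assoc D'D D'D_left)
qed

text \<open>\<open>A\<close> and \<open>B\<close> each invert \<open>D\<close>, so
  \<open>B \<circ> A\<close> commutes with it; this passes to powers of one factor, then of the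
  other.\<close>

lemma rot_comm:
  "zpow (B \<circ> A) (A \<circ> B) j \<circ> zpow D D' i = zpow D D' i \<circ> zpow (B \<circ> A) (A \<circ> B) j"
proof (rule zpow_intertwine)
  let ?R = "zpow (B \<circ> A) (A \<circ> B) j"
  have "D \<circ> (B \<circ> A) = B \<circ> A \<circ> D" "D \<circ> (A \<circ> B) = A \<circ> B \<circ> D"
    by (simp_all only: comp_assoc AD BD) (simp_all only: DA DB flip: comp_assoc)
  then have 1: "D \<circ> ?R = ?R \<circ> D"
    by (rule zpow_intertwine)
  then have "D' \<circ> (D \<circ> ?R) \<circ> D' = D' \<circ> (?R \<circ> D) \<circ> D'" by simp
  then show "?R \<circ> D' = D' \<circ> ?R" by (simp add: comp_assoc D'D_left DD')
  show "?R \<circ> D = D \<circ> ?R" by (simp add: 1)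
qed

lemma dact_rot_add: "dact (False, t + u) = dact (False, t) \<circ> dact (False, u)"
proof -
  obtain i j i' j' where [simp]: "t = (i, j)" "u = (i', j')" by (cases t, cases u)
  have inv: "(B \<circ> A) \<circ> (A \<circ> B) = id" "(A \<circ> B) \<circ> (B \<circ> A) = id"
    by (simp_all add: comp_assoc AA BB AA_left BB_left)
  show ?thesis
    by (simp add: dact_def zpow_add [OF inv] zpow_add [OF DD' D'D])
      (metis comp_assoc rot_comm)
qed

lemma dact_refl: "dact (True, t) = dact (False, t) \<circ> A"
  by (cases t) (simp add: dact_def)

lemma A_dact_rot: "A \<circ> dact (False, t) = dact (False, - t) \<circ> A"
proof -
  obtain i j where [simp]: "t = (i, j)" by (cases t)
  have 1: "A \<circ> zpow D D' i = zpow D' D i \<circ> A"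
    by (rule zpow_intertwine) (simp_all add: AD DA)
  have 2: "A \<circ> zpow (B \<circ> A) (A \<circ> B) j = zpow (A \<circ> B) (B \<circ> A) j \<circ> A"
    by (rule zpow_intertwine) (simp_all add: comp_assoc AA AA_left)
  show ?thesis
    by (simp add: dact_def zpow_uminus) (metis 1 2 comp_assoc)
qed

lemma A_left_rot: "A \<circ> (dact (False, t) \<circ> f) = dact (False, - t) \<circ> (A \<circ> f)"
  by (simp add: A_dact_rot flip: comp_assoc)

text \<open>The order is reversed because group elements, like words, act from left to
  right.\<close>

lemma dact_dmul: "dact (g \<cdot> h) = dact h \<circ> dact g"
proof -
  obtain \<delta> t \<epsilon> u where [simp]: "g = (\<delta>, t)" "h = (\<epsilon>, u)" by (cases g, cases h)
  show ?thesis
    by (cases \<delta>; cases \<epsilon>)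
      (simp_all add: dmul_def dact_refl A_left_rot dact_rot_add comp_assoc A_dact_rot AA_left AA
        diff_conv_add_uminus del: add_uminus_conv_diff)
qed

lemma dact_simps [simp]:
  "dact (False, 0) = id" "dact (True, 0) = A" "dact (False, 1, 0) = D"
  "dact (False, - 1, 0) = D'" "dact (True, 0, 1) = B"
  by (simp_all add: dact_def zero_prod_def comp_assoc AA)

lemma dact_dinv [simp]: "dact g \<circ> dact (dinv g) = id" "dact (dinv g) \<circ> dact g = id"
  by (simp_all flip: dact_dmul)

end


section \<open>Plane lattices\<close>

text \<open>The lattice spanned by \<open>(N, 0)\<close> and \<open>(M, K)\<close>; the triangular
  basis allows reduction one coordinate at a time.\<close>

definition lat :: "int \<Rightarrow> int \<Rightarrow> int \<Rightarrow> (int \<times> int) set" where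
  "lat N M K = {(\<alpha> * N + \<beta> * M, \<beta> * K) | \<alpha> \<beta>. True}"

lemma latI: "(\<alpha> * N + \<beta> * M, \<beta> * K) \<in> lat N M K"
  by (auto simp: lat_def)

lemma lat_zero: "0 \<in> lat N M K"
  using latI [of 0 N 0 M K] by (simp add: zero_prod_def)

lemma lat_diff:
  assumes "t \<in> lat N M K" "u \<in> lat N M K"
  shows "t - u \<in> lat N M K"
proof -
  obtain \<alpha> \<beta> \<alpha>' \<beta>' where "t = (\<alpha> * N + \<beta> * M, \<beta> * K)" "u = (\<alpha>' * N + \<beta>' * M, \<beta>' * K)"
    using assms by (auto simp: lat_def)
  then have "t - u = ((\<alpha> - \<alpha>') * N + (\<beta> - \<beta>') * M, (\<beta> - \<beta>') * K)"
    by (simp add: algebra_simps)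
  then show ?thesis
    unfolding lat_def by blast
qed

lemma lat_uminus: "t \<in> lat N M K \<Longrightarrow> - t \<in> lat N M K"
  using lat_diff [OF lat_zero] by simp

lemma lat_add: "t \<in> lat N M K \<Longrightarrow> u \<in> lat N M K \<Longrightarrow> t + u \<in> lat N M K"
  using lat_diff [OF _ lat_uminus] by simp

text \<open>Multiples of the basis vectors are reached by induction in both directions, with zero
  obtained as a vector plus its negative.\<close>

lemma lat_subset:
  assumes "(N, 0) \<in> S" "(M, K) \<in> S"
    and add: "\<And>t u. t \<in> S \<Longrightarrow> u \<in> S \<Longrightarrow> t + u \<in> S"
    and minus: "\<And>t. t \<in> S \<Longrightarrow> - t \<in> S"
  shows "lat N M K \<subseteq> S"
proof -
  have mult: "(\<gamma> * i, \<gamma> * j) \<in> S" if ij: "(i, j) \<in> S" for \<gamma> i j :: int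
  proof (induction \<gamma> rule: int_induct [where k = 0])
    case base
    show ?case using add [OF ij minus [OF ij]] by simp
  next
    case (step1 \<gamma>)
    then show ?case using add [OF step1(2) ij] by (simp add: algebra_simps)
  next
    case (step2 \<gamma>)
    then show ?case using add [OF step2(2) minus [OF ij]] by (simp add: algebra_simps)
  qed
  show ?thesis
  proof
    fix t assume "t \<in> lat N M K"
    then obtain \<alpha> \<beta> where "t = (\<alpha> * N, \<alpha> * 0) + (\<beta> * M, \<beta> * K)"
      by (auto simp: lat_def)
    then show "t \<in> S"
      using add mult assms(1,2) by metis
  qed
qed

text \<open>Representative in a box: copies of \<open>(M, K)\<close> bring the second coordinate
  into range, then copies of \<open>(N, 0)\<close> the first.\<close>

definition lat_reduce :: "int \<Rightarrow> int \<Rightarrow> int \<Rightarrow> int \<times> int \<Rightarrow> int \<times> int" where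
  "lat_reduce N M K = (\<lambda>(i, j). ((i - j div K * M) mod N, j mod K))"

lemma lat_reduce_eq_iff:
  assumes "0 < K"
  shows "lat_reduce N M K t = lat_reduce N M K u \<longleftrightarrow> t - u \<in> lat N M K"
proof -
  obtain i j i' j' where tu: "t = (i, j)" "u = (i', j')" by (cases t, cases u)
  show ?thesis
  proof
    assume eq: "lat_reduce N M K t = lat_reduce N M K u"
    \<comment> \<open>The difference of the quotients is the coefficient of
      \<open>(M, K)\<close>.\<close>
    then have "j - j' = (j div K - j' div K) * K"
      by (simp add: lat_reduce_def tu left_diff_distrib minus_mod_eq_div_mult [symmetric])
    moreover have "N dvd (i - j div K * M) - (i' - j' div K * M)"
      using eq by (simp add: lat_reduce_def tu mod_eq_dvd_iff)
    then obtain \<alpha> where "(i - j div K * M) - (i' - j' div K * M) = N * \<alpha>" ..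
    then have "i - i' = \<alpha> * N + (j div K - j' div K) * M"
      by (simp add: algebra_simps)
    ultimately show "t - u \<in> lat N M K"
      unfolding lat_def tu by auto
  next
    assume "t - u \<in> lat N M K"
    then obtain \<alpha> \<beta> where i: "i = i' + \<alpha> * N + \<beta> * M" and j: "j = j' + \<beta> * K"
      by (auto simp: lat_def tu algebra_simps)
    have "j div K = j' div K + \<beta>"
      using assms by (simp add: j)
    then have "i - j div K * M = (i' - j' div K * M) + \<alpha> * N"
      by (simp add: i algebra_simps)
    then show "lat_reduce N M K t = lat_reduce N M K u"
      by (simp add: lat_reduce_def tu j)
  qed
qed

lemma lat_reduce_range:
  "0 < N \<Longrightarrow> 0 < K \<Longrightarrow> lat_reduce N M K t \<in> {0..<N} \<times> {0..<K}"
  by (auto simp: lat_reduce_def split_beta)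

lemma lat_reduce_id: "t \<in> {0..<N} \<times> {0..<K} \<Longrightarrow> lat_reduce N M K t = t"
  by (auto simp: lat_reduce_def)


section \<open>The model\<close>

locale strut_twist =
  fixes k m n :: nat
  assumes k_pos: "k \<ge> 1" and m_pos: "m \<ge> 1" and n_pos: "n \<ge> 1"
begin

definition refl_arc :: "arc \<Rightarrow> bool" where
  "refl_arc s \<longleftrightarrow> s \<noteq> C \<and> s \<noteq> D"

text \<open>The coordinates refer to the translations by \<open>d\<close> and by \<open>r = a b\<close>, and \<open>a\<close>, which is
  \<open>Strand 1\<close>, is the fixed reflection. By the crossing relations the translation by \<open>Strand i\<close>
  is \<open>a r\<^sup>1\<^sup>-\<^sup>i\<close>.\<close>

primrec vec :: "arc \<Rightarrow> int \<times> int" where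
  "vec (Strand i) = (0, 1 - int i)"
| "vec C = (- 1, - int k)"
| "vec D = (1, 0)"
| "vec E = (1, 0)"
| "vec F = (1, 1)"

definition arc_op :: "arc \<Rightarrow> dih" where
  "arc_op s = (refl_arc s, vec s)"

text \<open>Spanned by the vectors of \<open>d^n\<close> and of \<open>c^(-m)\<close>; these are the
  translations that the labels make trivial.\<close>

definition lat0 :: "(int \<times> int) set" where
  "lat0 = lat (int n) (int m) (int (k * m))"

text \<open>For a strut \<open>s\<close> this is the lattice spanned by \<open>lat0\<close> and
  \<open>vec s\<close>, in a triangular basis.\<close>

primrec stab_lat :: "arc \<Rightarrow> (int \<times> int) set" where
  "stab_lat (Strand i) = lat0"
| "stab_lat C = lat (int n) 1 (int k)"
| "stab_lat D = lat 1 0 (int (k * m))"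
| "stab_lat E = lat0"
| "stab_lat F = lat0"

text \<open>The subgroup generated by \<open>arc_op s\<close> and the translations by
  \<open>lat0\<close>.\<close>

definition stab :: "arc \<Rightarrow> dih set" where
  "stab s = {g. if fst g then refl_arc s \<and> snd g - vec s \<in> stab_lat s else snd g \<in> stab_lat s}"

definition trans0 :: "dih set" where
  "trans0 = {g. \<not> fst g \<and> snd g \<in> lat0}"

text \<open>The pair \<open>(s, g)\<close> stands for the element \<open>s\<^sup>g\<close>, that is, for the right coset of \<open>g\<close>
  modulo \<open>stab s\<close>.\<close>

definition elt_op :: "arc \<times> dih \<Rightarrow> dih" where
  "elt_op x = dinv (snd x) \<cdot> arc_op (fst x) \<cdot> snd x"

text \<open>Strands of equal parity lie in one orbit. Conjugating a reflection by a power of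
  \<open>r\<close> shifts its exponent by twice that power, hence \<open>i div 2\<close>.\<close>

primrec arc_elt :: "arc \<Rightarrow> arc \<times> dih" where
  "arc_elt (Strand i) = (Strand (i mod 2), False, 0, - int (i div 2))"
| "arc_elt C = (C, False, 0)"
| "arc_elt D = (D, False, 0)"
| "arc_elt E = (E, False, 0)"
| "arc_elt F = (F, False, 0)"

text \<open>Evaluation works on coset representatives in the group over the whole plane lattice; the
  quotient enters only through \<open>sim\<close>.\<close>

primrec ev :: "arc qterm \<Rightarrow> arc \<times> dih" where
  "ev (Gen s) = arc_elt s"
| "ev (Rhd x y) = (fst (ev x), snd (ev x) \<cdot> elt_op (ev y))"
| "ev (RhdInv x y) = (fst (ev x), snd (ev x) \<cdot> dinv (elt_op (ev y)))"

definition sim :: "arc \<times> dih \<Rightarrow> arc \<times> dih \<Rightarrow> bool" where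
  "sim x y \<longleftrightarrow> fst x = fst y \<and> snd x \<cdot> dinv (snd y) \<in> stab (fst x)"

fun word_op :: "(arc \<times> bool) list \<Rightarrow> dih" where
  "word_op [] = (False, 0)"
| "word_op ((y, pos) # w) = (if pos then arc_op y else dinv (arc_op y)) \<cdot> word_op w"

lemma elt_op_arc [simp]: "elt_op (arc_elt s) = arc_op s"
proof (cases s)
  case (Strand i)
  have "i mod 2 + 2 * (i div 2) = i" by simp
  then have "int (i mod 2) + 2 * int (i div 2) = int i" by presburger
  with Strand show ?thesis
    by (simp add: elt_op_def arc_op_def dmul_def dinv_def refl_arc_def)
qed (auto simp: elt_op_def arc_op_def dmul_def dinv_def refl_arc_def prod_eq_iff)

lemma ev_act: "ev (act x w) = (fst (ev x), snd (ev x) \<cdot> word_op w)"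
proof (induction w arbitrary: x)
  case (Cons l w)
  then show ?case by (cases l; cases "snd l") (auto simp: dmul_assoc)
qed simp

text \<open>The basis vector \<open>(m, k * m)\<close> is \<open>m\<close> times
  \<open>(1, k)\<close> for \<open>C\<close>, and \<open>(m, 0) + (0, k * m)\<close> for
  \<open>D\<close>.\<close>

lemma lat0_subset: "lat0 \<subseteq> stab_lat s"
proof -
  have "lat0 \<subseteq> lat (int n) 1 (int k)"
    using latI [of 1 "int n" 0 1 "int k"] latI [of 0 "int n" "int m" 1 "int k"]
    unfolding lat0_def by (intro lat_subset lat_add lat_uminus) (simp_all add: mult.commute)
  moreover have "lat0 \<subseteq> lat 1 0 (int (k * m))"
    using latI [of "int n" 1 0 0 "int (k * m)"] latI [of "int m" 1 1 0 "int (k * m)"]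
    unfolding lat0_def by (intro lat_subset lat_add lat_uminus) simp_all
  ultimately show ?thesis
    by (cases s) simp_all
qed

section \<open>Closure properties of the stabilisers\<close>

lemma stab_lat_eq_lat0: "refl_arc s \<Longrightarrow> stab_lat s = lat0"
  by (cases s) (auto simp: refl_arc_def)

lemma stab_lat_closed:
  "0 \<in> stab_lat s"
  "t \<in> stab_lat s \<Longrightarrow> - t \<in> stab_lat s"
  "t \<in> stab_lat s \<Longrightarrow> u \<in> stab_lat s \<Longrightarrow> t + u \<in> stab_lat s"
  "t \<in> stab_lat s \<Longrightarrow> u \<in> stab_lat s \<Longrightarrow> t - u \<in> stab_lat s"
  by (cases s; simp add: lat0_def lat_zero lat_uminus lat_add lat_diff)+

lemma lat0_closed:
  "0 \<in> lat0" "t \<in> lat0 \<Longrightarrow> - t \<in> lat0"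
  "t \<in> lat0 \<Longrightarrow> u \<in> lat0 \<Longrightarrow> t + u \<in> lat0"
  using stab_lat_closed [where s = E] by simp_all

lemma stab_mult:
  assumes "g \<in> stab s" "h \<in> stab s"
  shows "g \<cdot> h \<in> stab s"
proof -
  obtain \<delta> t \<epsilon> u where gh: "g = (\<delta>, t)" "h = (\<epsilon>, u)" by (cases g, cases h)
  \<comment> \<open>One identity for each case with a reflection, splitting the vector to be tested
    into two members of \<open>stab_lat s\<close>.\<close>
  have eqs: "u - t = (u - vec s) - (t - vec s)" "u - t - vec s = (u - vec s) - t"
    "u + t - vec s = u + (t - vec s)"
    by simp_all
  show ?thesis
  proof (cases \<delta>; cases \<epsilon>)
    assume "\<delta>" "\<epsilon>"
    then show ?thesis
      using assms unfolding gh by (simp add: stab_def dmul_def) (metis eqs(1) stab_lat_closed(4))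
  next
    assume "\<delta>" "\<not> \<epsilon>"
    then show ?thesis
      using assms unfolding gh by (simp add: stab_def dmul_def) (metis eqs(3) stab_lat_closed(3))
  next
    assume "\<not> \<delta>" "\<epsilon>"
    then show ?thesis
      using assms unfolding gh by (simp add: stab_def dmul_def) (metis eqs(2) stab_lat_closed(4))
  next
    assume "\<not> \<delta>" "\<not> \<epsilon>"
    then show ?thesis
      using assms unfolding gh by (simp add: stab_def dmul_def stab_lat_closed)
  qed
qed

lemma stab_inv: "g \<in> stab s \<Longrightarrow> dinv g \<in> stab s"
  by (auto simp: stab_def dinv_def stab_lat_closed)

lemma trans0_stab: "g \<in> trans0 \<Longrightarrow> g \<in> stab s"
  using lat0_subset by (auto simp: stab_def trans0_def)

lemma trans0_inv: "g \<in> trans0 \<Longrightarrow> dinv g \<in> trans0"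
  by (auto simp: trans0_def dinv_def lat0_closed)

text \<open>Normality: conjugation by a reflection only negates the vector.\<close>

lemma trans0_conj: "g \<in> trans0 \<Longrightarrow> dinv h \<cdot> g \<cdot> h \<in> trans0"
  by (auto simp: trans0_def dinv_def dmul_def lat0_closed)

lemma trans0_conj': "g \<in> trans0 \<Longrightarrow> h \<cdot> g \<cdot> dinv h \<in> trans0"
  using trans0_conj [of g "dinv h"] by simp

text \<open>Needed for \<open>elt_op\<close> to be well defined on cosets modulo
  \<open>trans0\<close>. For a reflection arc the commutator is twice a vector of
  \<open>lat0\<close>, up to sign; for a strut all elements involved are translations and
  commute.\<close>

lemma stab_commutator:
  assumes "p \<in> stab s"
  shows "dinv p \<cdot> arc_op s \<cdot> p \<cdot> dinv (arc_op s) \<in> trans0"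
proof (cases "refl_arc s")
  case True
  obtain \<delta> t where p: "p = (\<delta>, t)" by (cases p)
  show ?thesis
  proof (cases \<delta>)
    case True
    then have "t - vec s \<in> lat0"
      using assms stab_lat_eq_lat0 by (auto simp: stab_def p)
    then have "- ((t - vec s) + (t - vec s)) \<in> lat0"
      by (intro lat0_closed)
    then show ?thesis
      using True \<open>refl_arc s\<close> by (simp add: p trans0_def dinv_def dmul_def arc_op_def algebra_simps)
  next
    case False
    then have "t \<in> lat0"
      using assms stab_lat_eq_lat0 \<open>refl_arc s\<close> by (auto simp: stab_def p)
    then have "- (t + t) \<in> lat0"
      by (intro lat0_closed)
    then show ?thesis
      using False \<open>refl_arc s\<close> by (simp add: p trans0_def dinv_def dmul_def arc_op_def algebra_simps)
  qed
next
  case False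
  then show ?thesis
    using assms by (auto simp: stab_def trans0_def dinv_def dmul_def arc_op_def lat0_closed)
qed

section \<open>The quandle of cosets on representatives\<close>

lemma sim_refl: "sim x x"
  using lat0_closed by (simp add: sim_def trans0_def trans0_stab)

lemma sim_sym: "sim x y \<Longrightarrow> sim y x"
  unfolding sim_def using stab_inv by fastforce

lemma sim_trans: "sim x y \<Longrightarrow> sim y z \<Longrightarrow> sim x z"
  unfolding sim_def using stab_mult by (fastforce simp: dmul_assoc)

text \<open>By normality of \<open>trans0\<close>, the factor \<open>h \<cdot> dinv h'\<close> can
  be moved to the left of \<open>g\<close> by conjugation, where it lies in the stabiliser.\<close>

lemma sim_mult:
  assumes "sim (s, g) (s', g')" "h \<cdot> dinv h' \<in> trans0"
  shows "sim (s, g \<cdot> h) (s', g' \<cdot> h')"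
proof -
  have "g \<cdot> (h \<cdot> dinv h') \<cdot> dinv g \<in> stab s"
    using assms(2) trans0_conj' trans0_stab by blast
  with assms(1) have "g \<cdot> (h \<cdot> dinv h') \<cdot> dinv g \<cdot> (g \<cdot> dinv g') \<in> stab s"
    by (auto intro: stab_mult simp: sim_def)
  with assms(1) show ?thesis
    by (simp add: sim_def dmul_assoc)
qed

lemma sim_mult_trans0: "h \<in> trans0 \<Longrightarrow> sim (s, g \<cdot> h) (s, g)"
  using sim_mult [OF sim_refl, of h "(False, 0)"] by (simp add: dinv_def)

text \<open>The quotient of the two operators is a conjugate of the commutator treated in
  \<open>stab_commutator\<close>.\<close>

lemma elt_op_cong:
  assumes "sim x y"
  shows "elt_op x \<cdot> dinv (elt_op y) \<in> trans0"
proof -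
  define p where "p = snd x \<cdot> dinv (snd y)"
  have x: "snd x = p \<cdot> snd y" and s: "fst x = fst y" "p \<in> stab (fst y)"
    using assms by (auto simp: sim_def p_def dmul_assoc)
  show ?thesis
    using trans0_conj [OF stab_commutator [OF s(2)], of "snd y"]
    by (simp add: elt_op_def x s(1) dmul_assoc)
qed

lemma elt_op_cong_inv:
  assumes "sim x y"
  shows "dinv (elt_op x) \<cdot> elt_op y \<in> trans0"
  using trans0_conj [OF trans0_inv [OF elt_op_cong [OF assms]], of "elt_op x"]
  by (simp add: dmul_assoc)

lemma vec_stab_lat:
  assumes "\<not> refl_arc s"
  shows "vec s \<in> stab_lat s"
proof -
  have "(- 1, - int k) \<in> lat (int n) 1 (int k)" "(1, 0) \<in> lat 1 0 (int (k * m))"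
    using latI [of 0 "int n" "- 1" 1 "int k"] latI [of 1 1 0 0 "int (k * m)"] by simp_all
  then show ?thesis
    using assms by (auto simp: refl_arc_def)
qed

text \<open>Acting on \<open>s^g\<close> by itself multiplies \<open>g\<close> on the left by
  \<open>arc_op s\<close>, an element of \<open>stab s\<close>.\<close>

lemma sim_idem: "sim (s, g \<cdot> elt_op (s, g)) (s, g)"
  by (simp add: sim_def elt_op_def dmul_assoc stab_def arc_op_def stab_lat_closed vec_stab_lat)


subsection \<open>The presentation\<close>

abbreviation "graph \<equiv> strut_twist_graph k"

definition words :: "(arc \<times> bool) list set" where
  "words = vertices graph \<union> {replicate 2 (Strand i, True) | i. i \<le> k + 1} \<union>
    {replicate m (C, True), replicate n (D, True), replicate 2 (E, True), replicate 2 (F, True)}"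

definition rels :: "(arc qterm \<times> arc qterm) set" where
  "rels = crossing_rels graph \<union> {(act x w, x) | x w. x \<in> qterms (arcs graph) \<and> w \<in> words}"

sublocale quandle_presentation "arcs graph" rels .

text \<open>Odd and even strands form the edges with indices 0 and 1, both labelled 2, so the parity
  condition disappears.\<close>

lemma fundamental_N_quandle_eq: "fundamental_N_quandle graph [2, 2, m, n, 2, 2] = Q"
proof -
  let ?N = "[2, 2, m, n, 2, 2]"
  let ?W = "{replicate 2 (Strand i, True) | i. i \<le> k + 1} \<union>
    {replicate m (C, True), replicate n (D, True), replicate 2 (E, True), replicate 2 (F, True)}"
  have "{replicate (?N ! i) (y, True) | i y. i < 6 \<and> y \<in> edges graph ! i} = ?W" (is "?L = _")
  proof
    show "?L \<subseteq> ?W"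
      by (auto simp: strut_twist_graph_def less_Suc_eq numeral_eq_Suc)
    have L: "replicate (?N ! i) (y, True) \<in> ?L" if "i < 6" "y \<in> edges graph ! i" for i y
      using that by blast
    have "replicate 2 (Strand i, True) \<in> ?L" if "i \<le> k + 1" for i
      using that L [of 0 "Strand i"] L [of 1 "Strand i"]
      by (cases "odd i") (simp_all add: strut_twist_graph_def)
    moreover have "replicate m (C, True) \<in> ?L" "replicate n (D, True) \<in> ?L"
      "replicate 2 (E, True) \<in> ?L" "replicate 2 (F, True) \<in> ?L"
      using L [of 2 C] L [of 3 D] L [of 4 E] L [of 5 F] by (simp_all add: strut_twist_graph_def)
    ultimately show "?W \<subseteq> ?L"
      by blast
  qed
  then have "words = vertices graph \<union> ?L"
    by (simp add: words_def Un_assoc)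
  moreover have "label_rels graph ?N = {(act x w, x) | x w. x \<in> qterms (arcs graph) \<and> w \<in> ?L}"
  proof -
    have "length (edges graph) = 6"
      by (simp add: strut_twist_graph_def)
    then show ?thesis
      unfolding label_rels_def mem_Collect_eq by (intro Collect_cong) metis
  qed
  ultimately have "crossing_rels graph \<union> vertex_rels graph \<union> label_rels graph ?N = rels"
    by (auto simp add: rels_def vertex_rels_def simp del: act_simps)
  then show ?thesis
    by (simp add: fundamental_N_quandle_def)
qed

lemma word_op_replicate:
  "arc_op y = (False, i, j) \<Longrightarrow> word_op (replicate l (y, True)) = (False, int l * i, int l * j)"
  by (induction l) (simp_all add: dmul_def zero_prod_def algebra_simps)

text \<open>Vertex words and squares of reflections are already trivial over the whole plane
  lattice; the label words of the struts give vectors of \<open>lat0\<close>.\<close>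

lemma word_op_words:
  assumes "w \<in> words"
  shows "word_op w \<in> trans0"
proof -
  \<comment> \<open>The coefficients 0 and 1 are kept visible so that \<open>latI\<close>
    matches.\<close>
  have C: "word_op (replicate m (C, True)) = (False, - (0 * int n + 1 * int m, 1 * int (k * m)))"
    using word_op_replicate [of C] by (simp add: arc_op_def refl_arc_def)
  have D: "word_op (replicate n (D, True)) = (False, 1 * int n + 0 * int m, 0 * int (k * m))"
    using word_op_replicate [of D] by (simp add: arc_op_def refl_arc_def)
  have CD: "word_op (replicate m (C, True)) \<in> trans0" "word_op (replicate n (D, True)) \<in> trans0"
    unfolding C D trans0_def lat0_def
    by (simp_all only: mem_Collect_eq fst_conv snd_conv not_False_eq_True simp_thms
        lat_uminus latI)
  have 2: "word_op (replicate 2 (y, True)) = (False, 0)" if "refl_arc y" for y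
    using that by (simp add: numeral_2_eq_2 arc_op_def dmul_def)
  have "word_op w = (False, 0)" if "w \<in> vertices graph"
    using that
    by (auto simp: strut_twist_graph_def arc_op_def dmul_def dinv_def refl_arc_def prod_eq_iff)
  then show ?thesis
    using assms CD 2 by (auto simp: words_def trans0_def lat0_closed refl_arc_def)
qed

text \<open>Soundness of the coset model: distinct cosets come from distinct classes, which bounds
  the quandle from below.\<close>

lemma sim_ev: "qeq (arcs graph) rels x y \<Longrightarrow> sim (ev x) (ev y)"
proof (induction rule: qeq.induct)
  case (rel s t)
  then consider \<chi> where "\<chi> \<in> crossings graph"
      "s = Gen (under_right \<chi>)" "t = Rhd (Gen (under_left \<chi>)) (Gen (over \<chi>))"
    | w where "w \<in> words" "s = act t w"
    by (auto simp: rels_def crossing_rels_def)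
  then show ?case
  proof cases
    case 1
    then obtain j where "1 \<le> j" "s = Gen (Strand (j - 1))"
      "t = Rhd (Gen (Strand (j + 1))) (Gen (Strand j))"
      by (auto simp: strut_twist_graph_def)
    then obtain i where i: "s = Gen (Strand i)" "t = Rhd (Gen (Strand (i + 2))) (Gen (Strand (i + 1)))"
      by (cases j) auto
    have t: "ev t = (Strand (i mod 2),
        snd (arc_elt (Strand (i + 2))) \<cdot> arc_op (Strand (i + 1)))"
      unfolding i ev.simps elt_op_arc by simp
    have "int (i mod 2) + 2 * int (i div 2) = int i" by presburger
    \<comment> \<open>The two representatives differ by the operator of their orbit representative,
      which lies in its stabiliser.\<close>
    then have "snd (ev s) \<cdot> dinv (snd (ev t)) = arc_op (Strand (i mod 2))"
      unfolding t by (simp add: i(1) dmul_def dinv_def arc_op_def refl_arc_def)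
    then show ?thesis
      by (simp add: sim_def t) (simp add: i(1) stab_def arc_op_def refl_arc_def lat0_closed)
  next
    case 2
    then show ?thesis
      using sim_mult_trans0 [OF word_op_words, of w "fst (ev t)" "snd (ev t)"] by (simp add: ev_act)
  qed
next
  case (idem x)
  then show ?case using sim_idem [of "fst (ev x)" "snd (ev x)"] by simp
next
  case (cong_rhd x x' y y')
  then show ?case using sim_mult elt_op_cong by simp
next
  case (cong_rhd_inv x x' y y')
  then show ?case using sim_mult elt_op_cong_inv by simp
next
  case (sym x y)
  then show ?case by (simp add: sim_sym)
next
  case (trans x y z)
  then show ?case by (blast intro: sim_trans)
qed (simp_all add: elt_op_def dmul_assoc sim_refl)

subsection \<open>The translations of the presented quandle\<close>

abbreviation "ta s \<equiv> trl (gen s)"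
abbreviation "ta_inv s \<equiv> trl_inv (gen s)"

lemma arcs_graph: "s \<in> arcs graph \<longleftrightarrow> (\<forall>i. s = Strand i \<longrightarrow> i \<le> k + 1)"
  by (cases s) (auto simp: strut_twist_graph_def)

lemma words_arcs: "w \<in> words \<Longrightarrow> fst ` set w \<subseteq> arcs graph"
  by (auto simp: words_def strut_twist_graph_def split: if_splits)

lemma word_trl_words: "w \<in> words \<Longrightarrow> word_trl w = id"
  by (rule word_trl_relator [OF words_arcs]) (auto simp: rels_def)

lemma ta_invol:
  assumes "s \<in> arcs graph" "refl_arc s"
  shows "ta s \<circ> ta s = id"
proof -
  have "replicate 2 (s, True) \<in> words"
    using assms by (cases s) (auto simp: arcs_graph words_def refl_arc_def)
  from word_trl_words [OF this] show ?thesis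
    by (simp add: fun_eq_iff numeral_2_eq_2)
qed

lemma vertex_trl:
  "ta (Strand 1) \<circ> ta E \<circ> ta D = id"
  "ta_inv D \<circ> ta F \<circ> ta (Strand 0) = id"
  "ta_inv E \<circ> ta_inv (Strand (k + 1)) \<circ> ta C = id"
proof -
  have "[(D, True), (E, True), (Strand 1, True)] \<in> words"
    "[(Strand 0, True), (F, True), (D, False)] \<in> words"
    "[(C, True), (Strand (k + 1), False), (E, False)] \<in> words"
    by (simp_all add: words_def strut_twist_graph_def)
  from this [THEN word_trl_words] show
    "ta (Strand 1) \<circ> ta E \<circ> ta D = id"
    "ta_inv D \<circ> ta F \<circ> ta (Strand 0) = id"
    "ta_inv E \<circ> ta_inv (Strand (k + 1)) \<circ> ta C = id"
    by (simp_all add: fun_eq_iff)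
qed

lemma ta_E: "ta E = ta (Strand 1) \<circ> ta_inv D"
proof -
  have "ta (Strand 1) \<circ> (ta (Strand 1) \<circ> ta E \<circ> ta D) \<circ> ta_inv D
      = (ta (Strand 1) \<circ> ta (Strand 1)) \<circ> ta E \<circ> (ta D \<circ> ta_inv D)"
    by (simp only: comp_assoc)
  then show ?thesis
    by (simp add: vertex_trl(1)[simplified] ta_invol arcs_graph refl_arc_def)
qed

lemma ta_F: "ta F = ta D \<circ> ta (Strand 0)"
proof -
  have "ta D \<circ> (ta_inv D \<circ> ta F \<circ> ta (Strand 0)) \<circ> ta (Strand 0)
      = (ta D \<circ> ta_inv D) \<circ> ta F \<circ> (ta (Strand 0) \<circ> ta (Strand 0))"
    by (simp only: comp_assoc)
  then show ?thesis
    by (simp add: vertex_trl(2) ta_invol arcs_graph refl_arc_def)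
qed

lemma ta_C: "ta C = ta (Strand (k + 1)) \<circ> ta E"
proof -
  have "ta (Strand (k + 1)) \<circ> (ta E \<circ> (ta_inv E \<circ> ta_inv (Strand (k + 1)) \<circ> ta C))
      = (ta (Strand (k + 1)) \<circ> ((ta E \<circ> ta_inv E) \<circ> ta_inv (Strand (k + 1)))) \<circ> ta C"
    by (simp only: comp_assoc)
  then show ?thesis
    by (simp add: vertex_trl(3)[simplified] arcs_graph)
qed

text \<open>That \<open>ta D\<close> is inverted by both strands restates that \<open>ta E\<close>
  and \<open>ta F\<close> are involutions, by \<open>ta_E\<close> and \<open>ta_F\<close>.\<close>

sublocale dih: dihedral_action "ta (Strand (Suc 0))" "ta D" "ta_inv D" "ta (Strand 0)"
proof
  let ?a = "ta (Strand (Suc 0))" and ?b = "ta (Strand 0)" and ?d = "ta D" and ?d' = "ta_inv D"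
  show aa: "?a \<circ> ?a = id" and bb: "?b \<circ> ?b = id"
    by (simp_all add: ta_invol arcs_graph refl_arc_def)
  show dd': "?d \<circ> ?d' = id" and d'd: "?d' \<circ> ?d = id"
    by (simp_all add: arcs_graph)
  have "?a \<circ> ?d' \<circ> (?a \<circ> ?d') = id"
    using ta_invol [of E] by (simp add: ta_E arcs_graph refl_arc_def)
  then have "?a \<circ> ?d' \<circ> (?a \<circ> ?d') \<circ> ?d \<circ> ?a = ?d \<circ> ?a"
    by simp
  moreover have "?a \<circ> ?d' \<circ> (?a \<circ> ?d') \<circ> ?d \<circ> ?a = ?a \<circ> (?d' \<circ> (?a \<circ> (?d' \<circ> ?d) \<circ> ?a))"
    by (simp only: comp_assoc)
  ultimately show "?d \<circ> ?a = ?a \<circ> ?d'"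
    using aa d'd by simp
  have "?d \<circ> ?b \<circ> (?d \<circ> ?b) = id"
    using ta_invol [of F] by (simp add: ta_F arcs_graph refl_arc_def)
  then have "?d \<circ> ?b \<circ> (?d \<circ> ?b) \<circ> (?b \<circ> ?d') = ?b \<circ> ?d'"
    by simp
  moreover have "?d \<circ> ?b \<circ> (?d \<circ> ?b) \<circ> (?b \<circ> ?d') = ?d \<circ> ?b \<circ> (?d \<circ> (?b \<circ> ?b) \<circ> ?d')"
    by (simp only: comp_assoc)
  ultimately show "?d \<circ> ?b = ?b \<circ> ?d'"
    using bb dd' by simp
qed

abbreviation "dact \<equiv> dih.dact"

lemma dact_inv:
  assumes "y \<in> carrier Q" "trl y = dact g"
  shows "trl_inv y = dact (dinv g)"
proof -
  have "trl_inv y = trl_inv y \<circ> (dact g \<circ> dact (dinv g))" by simp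
  also have "\<dots> = (trl_inv y \<circ> trl y) \<circ> dact (dinv g)"
    by (simp only: assms(2) comp_assoc)
  finally show ?thesis using assms(1) by simp
qed

text \<open>The crossing relation solved for the other under-arc, as the over-arc acts by an
  involution.\<close>

lemma gen_crossing:
  assumes "Suc i \<le> k"
  shows "gen (Strand (i + 2)) = ta (Strand (i + 1)) (gen (Strand i))"
proof -
  let ?s = "Strand i" and ?t = "Strand (i + 1)" and ?u = "Strand (i + 2)"
  have mem: "Gen ?s \<in> qterms (arcs graph)" "Gen ?t \<in> qterms (arcs graph)"
    "Gen ?u \<in> qterms (arcs graph)"
    using assms by (simp_all add: arcs_graph)
  have "\<lparr>over = ?t, under_left = ?u, under_right = ?s\<rparr> \<in> crossings graph"
    using assms by (auto simp: strut_twist_graph_def intro!: exI [of _ "i + 1"])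
  then have "(Gen ?s, Rhd (Gen ?u) (Gen ?t)) \<in> rels"
    unfolding rels_def crossing_rels_def by force
  then have "gen ?s = cls (Rhd (Gen ?u) (Gen ?t))"
    using mem by (subst qclass_eq_iff) (auto intro: qeq.rel)
  also have "\<dots> = ta ?t (gen ?u)"
    using mem by (simp add: trl_cls)
  finally show ?thesis
    using fun_cong [OF ta_invol, of ?t "gen ?u"] assms by (simp add: arcs_graph refl_arc_def)
qed

lemma dact_arc_op_gen:
  assumes "s \<in> arcs graph" "ta s = dact (arc_op s)"
  shows "dact (arc_op s) (gen s) = gen s"
  using assms trl_self [of "gen s"] by simp

text \<open>Along the block, each reflection is the one two places earlier conjugated by the one
  between: reflecting \<open>1 - j\<close> in \<open>- j\<close> gives
  \<open>1 - (j + 2)\<close>.\<close>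

lemma ta_Strand: "i \<le> k + 1 \<Longrightarrow> ta (Strand i) = dact (arc_op (Strand i))"
proof (induction i rule: induct_nat_012)
  case (ge2 j)
  let ?s = "Strand j" and ?t = "Strand (j + 1)"
  have IH: "ta ?s = dact (arc_op ?s)" "ta ?t = dact (arc_op ?t)"
    using ge2 by simp_all
  have mem: "gen ?s \<in> carrier Q" "gen ?t \<in> carrier Q"
    using ge2.prems by (simp_all add: arcs_graph)
  have "gen (Strand (j + 2)) = rhd Q (gen ?s) (gen ?t)"
    using gen_crossing [of j] ge2.prems mem by (simp add: trl_def)
  then have "ta (Strand (j + 2)) = dact (arc_op ?t) \<circ> dact (arc_op ?s) \<circ> dact (dinv (arc_op ?t))"
    using trl_rhd [OF mem] IH dact_inv [OF mem(2) IH(2)] by simp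
  also have "\<dots> = dact (dinv (arc_op ?t) \<cdot> arc_op ?s \<cdot> arc_op ?t)"
    by (simp only: dih.dact_dmul comp_assoc)
  also have "dinv (arc_op ?t) \<cdot> arc_op ?s \<cdot> arc_op ?t = arc_op (Strand (j + 2))"
    by (simp add: arc_op_def refl_arc_def dmul_def dinv_def)
  finally show ?case by simp
qed (simp_all add: arc_op_def refl_arc_def flip: zero_prod_def)

text \<open>The vertices at \<open>D\<close> determine \<open>E\<close> and \<open>F\<close>;
  \<open>C\<close> then follows from \<open>E\<close> and \<open>Strand (k + 1)\<close>, which
  brings in \<open>k\<close>.\<close>

lemma ta_arc_op:
  assumes "s \<in> arcs graph"
  shows "ta s = dact (arc_op s)"
proof -
  have E: "ta E = dact (arc_op E)"
  proof -
    have "ta E = dact (True, 0) \<circ> dact (False, - 1, 0)"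
      by (simp add: ta_E)
    also have "\<dots> = dact ((False, - 1, 0) \<cdot> (True, 0))"
      by (simp only: dih.dact_dmul)
    also have "(False, - 1, 0) \<cdot> (True, 0) = arc_op E"
      by (simp add: arc_op_def refl_arc_def dmul_def)
    finally show ?thesis .
  qed
  have F: "ta F = dact (arc_op F)"
  proof -
    have "ta F = dact (False, 1, 0) \<circ> dact (True, 0, 1)"
      by (simp add: ta_F)
    also have "\<dots> = dact ((True, 0, 1) \<cdot> (False, 1, 0))"
      by (simp only: dih.dact_dmul)
    also have "(True, 0, 1) \<cdot> (False, 1, 0) = arc_op F"
      by (simp add: arc_op_def refl_arc_def dmul_def)
    finally show ?thesis .
  qed
  have C: "ta C = dact (arc_op C)"
  proof -
    have "ta C = dact (arc_op (Strand (k + 1))) \<circ> dact (arc_op E)"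
      by (simp only: ta_C ta_Strand [OF order_refl] E)
    also have "\<dots> = dact (arc_op E \<cdot> arc_op (Strand (k + 1)))"
      by (simp only: dih.dact_dmul)
    also have "arc_op E \<cdot> arc_op (Strand (k + 1)) = arc_op C"
      by (simp add: arc_op_def refl_arc_def dmul_def)
    finally show ?thesis .
  qed
  have D: "ta D = dact (arc_op D)"
    by (simp add: arc_op_def refl_arc_def)
  show ?thesis
  proof (cases s)
    case (Strand i)
    then show ?thesis using assms ta_Strand [of i] by (simp add: arcs_graph)
  qed (hypsubst, rule C D E F)+
qed

lemma gen_Strand:
  "i \<le> k + 1 \<Longrightarrow> gen (Strand i) = dact (snd (arc_elt (Strand i))) (gen (Strand (i mod 2)))"
proof (induction i rule: induct_nat_012)
  case (ge2 j)
  let ?s = "Strand (j mod 2)" and ?g = "snd (arc_elt (Strand j))"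
  have s: "?s \<in> arcs graph"
    by (simp add: arcs_graph)
  have "gen (Strand (j + 2)) = ta (Strand (j + 1)) (gen (Strand j))"
    using gen_crossing [of j] ge2.prems by simp
  also have "\<dots> = dact (arc_op (Strand (j + 1))) (dact ?g (gen ?s))"
    using ge2 ta_Strand [of "j + 1"] by simp
  also have "\<dots> = dact (?g \<cdot> arc_op (Strand (j + 1))) (gen ?s)"
    by (simp only: dih.dact_dmul comp_apply)
  \<comment> \<open>The factor split off on the left fixes the orbit representative by idempotence
    and is dropped next.\<close>
  also have "?g \<cdot> arc_op (Strand (j + 1)) = arc_op ?s \<cdot> snd (arc_elt (Strand (j + 2)))"
  proof -
    have "int (j mod 2) + 2 * int (j div 2) = int j" by presburger
    then show ?thesis
      by (simp add: arc_op_def refl_arc_def dmul_def)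
  qed
  also have "dact \<dots> (gen ?s) = dact (snd (arc_elt (Strand (j + 2)))) (gen ?s)"
    by (simp only: dih.dact_dmul comp_apply dact_arc_op_gen [OF s ta_arc_op [OF s]])
  finally show ?case by simp
qed (simp_all flip: zero_prod_def)

lemma gen_arc_elt:
  assumes "s \<in> arcs graph"
  shows "gen s = dact (snd (arc_elt s)) (gen (fst (arc_elt s)))"
proof (cases s)
  case (Strand i)
  then have "i \<le> k + 1"
    using assms by (simp add: arcs_graph)
  from gen_Strand [OF this] show ?thesis
    unfolding Strand by (simp only: arc_elt.simps fst_conv)
qed (simp_all flip: zero_prod_def)

text \<open>The two claims are joined because locating a composite term in its orbit uses the
  translation by its right-hand part.\<close>

lemma cls_ev:
  assumes "y \<in> qterms (arcs graph)"
  shows "cls y = dact (snd (ev y)) (gen (fst (ev y))) \<and> trl (cls y) = dact (elt_op (ev y))"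
  using assms
proof (induction y)
  case (Gen s)
  then show ?case
    using gen_arc_elt ta_arc_op by simp
next
  case (Rhd x y)
  have mem: "x \<in> qterms (arcs graph)" "y \<in> qterms (arcs graph)"
    using Rhd.prems by simp_all
  have x: "cls x = dact (snd (ev x)) (gen (fst (ev x)))" "trl (cls x) = dact (elt_op (ev x))"
    and y: "trl (cls y) = dact (elt_op (ev y))"
    using Rhd.IH mem by blast+
  note y' = dact_inv [OF cls_closed [OF mem(2)] y]
  have "trl (rhd Q (cls x) (cls y)) = dact (elt_op (ev (Rhd x y)))"
    using mem by (simp add: trl_rhd x(2) y y' elt_op_def dih.dact_dmul comp_assoc)
  moreover have "trl (cls y) (cls x) = dact (snd (ev (Rhd x y))) (gen (fst (ev (Rhd x y))))"
    by (simp add: x(1) y y' dih.dact_dmul)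
  ultimately show ?case
    using mem by (simp add: trl_cls rhd_presented)
next
  case (RhdInv x y)
  have mem: "x \<in> qterms (arcs graph)" "y \<in> qterms (arcs graph)"
    using RhdInv.prems by simp_all
  have x: "cls x = dact (snd (ev x)) (gen (fst (ev x)))" "trl (cls x) = dact (elt_op (ev x))"
    and y: "trl (cls y) = dact (elt_op (ev y))"
    using RhdInv.IH mem by blast+
  note y' = dact_inv [OF cls_closed [OF mem(2)] y]
  have "trl (rhd_inv Q (cls x) (cls y)) = dact (elt_op (ev (RhdInv x y)))"
    using mem by (simp add: trl_rhd_inv x(2) y y' elt_op_def dih.dact_dmul comp_assoc)
  moreover have "trl_inv (cls y) (cls x) = dact (snd (ev (RhdInv x y))) (gen (fst (ev (RhdInv x y))))"
    by (simp add: x(1) y y' dih.dact_dmul)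
  ultimately show ?case
    using mem by (simp add: trl_inv_cls rhd_inv_presented)
qed

section \<open>The stabilisers of the generators\<close>

lemma word_trl_dact:
  "fst ` set w \<subseteq> arcs graph \<Longrightarrow> word_trl w = dact (word_op w)"
proof (induction w rule: word_op.induct)
  case (2 y pos w)
  then have "ta y = dact (arc_op y)" "ta_inv y = dact (dinv (arc_op y))"
    by (simp_all add: ta_arc_op dact_inv)
  with 2 show ?case
    by (cases pos) (simp_all add: fun_eq_iff dih.dact_dmul)
qed (simp add: fun_eq_iff)

lemma dact_periods:
  "dact (False, int n, 0) = id" "dact (False, - int m, - int (k * m)) = id"
proof -
  have "replicate n (D, True) \<in> words" "replicate m (C, True) \<in> words"
    by (simp_all add: words_def)
  from this [THEN word_trl_words] this [THEN words_arcs, THEN word_trl_dact]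
  show "dact (False, int n, 0) = id" "dact (False, - int m, - int (k * m)) = id"
    by (simp_all add: word_op_replicate arc_op_def refl_arc_def mult.commute)
qed

text \<open>Counterpart of \<open>sim_ev\<close>, bounding the quandle from above. The translations
  fixing \<open>gen s\<close> form a group containing both periods and, for a strut,
  \<open>vec s\<close>.\<close>

lemma dact_stab:
  assumes "s \<in> arcs graph" "g \<in> stab s"
  shows "dact g (gen s) = gen s"
proof -
  have op: "dact (arc_op s) (gen s) = gen s"
    using assms(1) dact_arc_op_gen ta_arc_op by blast
  let ?S = "{t. dact (False, t) (gen s) = gen s}"
  have add: "t + u \<in> ?S" if "t \<in> ?S" "u \<in> ?S" for t u
    using that by (simp add: dih.dact_rot_add)
  have minus: "- t \<in> ?S" if "t \<in> ?S" for t
  proof -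
    have "(dact (False, - t) \<circ> dact (False, t)) (gen s) = gen s"
      by (simp flip: dih.dact_rot_add)
    with that show ?thesis by simp
  qed
  have per: "(int n, 0) \<in> ?S" "(int m, int (k * m)) \<in> ?S"
    using minus [of "(- int m, - int (k * m))"] by (simp_all add: dact_periods del: of_nat_mult)
  have lat0: "lat0 \<subseteq> ?S"
    unfolding lat0_def by (rule lat_subset [OF per add minus])
  have rot: "stab_lat s \<subseteq> ?S"
  proof (cases s)
    case C
    have 1: "(1, int k) \<in> ?S"
      using op minus [of "(- 1, - int k)"] by (simp add: C arc_op_def refl_arc_def)
    have "lat (int n) 1 (int k) \<subseteq> ?S"
      by (rule lat_subset [OF per(1) 1 add minus])
    with C show ?thesis by simp
  next
    case D
    have 1: "(1, 0) \<in> ?S"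
      using op by (simp add: D arc_op_def refl_arc_def)
    \<comment> \<open>\<open>lat 1 0 0\<close> is the line through \<open>(1, 0)\<close>;
      subtracting \<open>(m, 0)\<close> turns the period \<open>(m, k * m)\<close> into
      \<open>(0, k * m)\<close>.\<close>
    have "lat 1 0 0 \<subseteq> ?S"
      by (rule lat_subset [OF 1 _ add minus]) (simp flip: zero_prod_def)
    then have "- (int m, 0) \<in> ?S"
      using latI [of "int m" 1 0 0 0] by (intro minus) auto
    from add [OF this per(2)] have 2: "(0, int (k * m)) \<in> ?S"
      by simp
    have "lat 1 0 (int (k * m)) \<subseteq> ?S"
      by (rule lat_subset [OF 1 2 add minus])
    with D show ?thesis by simp
  qed (use lat0 in simp_all)
  show ?thesis
  proof (cases "fst g")
    case True
    then have g: "g = arc_op s \<cdot> (False, snd g - vec s)"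
      using assms(2) by (simp add: stab_def arc_op_def dmul_def prod_eq_iff)
    have "snd g - vec s \<in> ?S"
      using assms(2) rot True by (auto simp: stab_def)
    then show ?thesis
      by (subst g) (simp only: dih.dact_dmul comp_apply op mem_Collect_eq)
  next
    case False
    then show ?thesis
      using assms(2) rot by (cases g) (auto simp: stab_def)
  qed
qed

lemma ev_arc: "x \<in> qterms (arcs graph) \<Longrightarrow> fst (ev x) \<in> {Strand 0, Strand 1, C, D, E, F}"
proof (induction x)
  case (Gen s)
  then show ?case by (cases s) auto
qed simp_all

lemma cls_eq_iff:
  assumes "x \<in> qterms (arcs graph)" "y \<in> qterms (arcs graph)"
  shows "cls x = cls y \<longleftrightarrow> sim (ev x) (ev y)"
proof
  assume "cls x = cls y"
  then show "sim (ev x) (ev y)"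
    using assms by (simp add: qclass_eq_iff sim_ev)
next
  assume sim: "sim (ev x) (ev y)"
  let ?p = "snd (ev x) \<cdot> dinv (snd (ev y))"
  have s: "fst (ev y) \<in> arcs graph"
    using ev_arc [OF assms(2)] by (auto simp: arcs_graph)
  have "cls x = dact (?p \<cdot> snd (ev y)) (gen (fst (ev y)))"
    using cls_ev [OF assms(1)] sim by (simp add: sim_def dmul_assoc)
  also have "\<dots> = dact (snd (ev y)) (dact ?p (gen (fst (ev y))))"
    by (simp only: dih.dact_dmul comp_apply)
  also have "dact ?p (gen (fst (ev y))) = gen (fst (ev y))"
    using sim s by (auto intro!: dact_stab simp: sim_def)
  finally show "cls x = cls y"
    using cls_ev [OF assms(2)] by simp
qed


subsection \<open>Counting normal forms\<close>

primrec stab_reduce :: "arc \<Rightarrow> int \<times> int \<Rightarrow> int \<times> int" where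
  "stab_reduce (Strand i) = lat_reduce (int n) (int m) (int (k * m))"
| "stab_reduce C = lat_reduce (int n) 1 (int k)"
| "stab_reduce D = lat_reduce 1 0 (int (k * m))"
| "stab_reduce E = lat_reduce (int n) (int m) (int (k * m))"
| "stab_reduce F = lat_reduce (int n) (int m) (int (k * m))"

text \<open>For a reflection arc, left multiplication by \<open>arc_op s\<close> removes the
  reflection within the coset; for a strut the flag remains as an invariant.\<close>

definition reduce :: "arc \<times> dih \<Rightarrow> arc \<times> dih" where
  "reduce = (\<lambda>(s, \<delta>, t).
    (s, \<delta> \<and> \<not> refl_arc s, stab_reduce s (if \<delta> \<and> refl_arc s then t - vec s else t)))"

text \<open>Four orbits of size \<open>k * m * n\<close>, then \<open>2 * k * n\<close> elements for
  \<open>C\<close> and \<open>2 * k * m\<close> for \<open>D\<close>.\<close>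

definition normal_forms :: "(arc \<times> dih) set" where
  "normal_forms =
    {Strand 0, Strand 1, E, F} \<times> {False} \<times> {0..<int n} \<times> {0..<int (k * m)} \<union>
    {C} \<times> UNIV \<times> {0..<int n} \<times> {0..<int k} \<union>
    {D} \<times> UNIV \<times> {0..<1} \<times> {0..<int (k * m)}"

lemma card_normal_forms: "card normal_forms = 4 * k * m * n + 2 * k * m + 2 * k * n"
  unfolding normal_forms_def
  by (subst card_Un_disjoint; (subst card_Un_disjoint)?)
    (auto simp: card_cartesian_product algebra_simps simp del: of_nat_mult)

lemma km_pos: "0 < int (k * m)" "0 < int k" "0 < int m" "0 < int n"
  using k_pos m_pos n_pos by simp_all

lemma stab_reduce_eq_iff: "stab_reduce s t = stab_reduce s u \<longleftrightarrow> t - u \<in> stab_lat s"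
  using km_pos by (cases s) (simp_all add: lat_reduce_eq_iff lat0_def del: of_nat_mult)

lemma sim_iff_reduce: "sim x y \<longleftrightarrow> reduce x = reduce y"
proof -
  obtain s \<delta> t s' \<epsilon> u where xy: "x = (s, \<delta>, t)" "y = (s', \<epsilon>, u)" by (cases x, cases y)
  have minus: "v \<in> stab_lat r \<longleftrightarrow> w \<in> stab_lat r" if "w = - v" for v w r
    using stab_lat_closed(2) [of v r] stab_lat_closed(2) [of w r] that by auto
  \<comment> \<open>A reflection as second factor negates the first vector, so differences occur
    with either sign.\<close>
  have neg: "u - t - vec r \<in> stab_lat r \<longleftrightarrow> t - (u - vec r) \<in> stab_lat r"
    "u - t \<in> stab_lat r \<longleftrightarrow> t - u \<in> stab_lat r" for r
    by (rule minus, simp)+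
  have comm: "t - u - vec r = t - vec r - u" for r
    by simp
  show ?thesis
    by (cases "s = s'"; cases \<delta>; cases \<epsilon>)
      (simp_all add: xy sim_def reduce_def stab_def dmul_def dinv_def stab_reduce_eq_iff neg comm)
qed

lemma reduce_ev:
  assumes "x \<in> qterms (arcs graph)"
  shows "reduce (ev x) \<in> normal_forms"
proof -
  obtain s \<delta> t where r: "reduce (ev x) = (s, \<delta> \<and> \<not> refl_arc s, stab_reduce s t)" "fst (ev x) = s"
    by (simp add: reduce_def split_beta)
  consider "s = Strand 0" | "s = Strand 1" | "s = C" | "s = D" | "s = E" | "s = F"
    using ev_arc [OF assms] r(2) by auto
  then show ?thesis
    using km_pos unfolding r(1) normal_forms_def
    by cases (simp_all add: refl_arc_def lat_reduce_range del: of_nat_mult)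
qed

lemma reduce_normal_form: "x \<in> normal_forms \<Longrightarrow> reduce x = x"
  by (auto simp: normal_forms_def reduce_def refl_arc_def lat_reduce_id simp del: of_nat_mult)

lemma word_op_append: "word_op (v @ w) = word_op v \<cdot> word_op w"
  by (induction v rule: word_op.induct) (simp_all add: dmul_assoc)

text \<open>The witness is \<open>s\<close> acted on by the word for
  \<open>a^\<delta> d^i r^j\<close>; natural exponents reach every normal form.\<close>

lemma ex_ev:
  assumes s: "s \<in> {Strand 0, Strand 1, C, D, E, F}"
  shows "\<exists>x\<in>qterms (arcs graph). ev x = (s, \<delta>, int i, int j)"
proof -
  define u where "u = (if \<delta> then [(Strand 1, True)] else [])"
  define v where "v = replicate i (D, True)"
  define w where "w = concat (replicate j [(Strand 1, True), (Strand 0, True)])"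
  have uvw: "word_op u = (\<delta>, 0)" "word_op v = (False, int i, 0)" "word_op w = (False, 0, int j)"
  proof -
    show "word_op u = (\<delta>, 0)"
      by (simp add: u_def arc_op_def refl_arc_def dmul_def zero_prod_def)
    show "word_op v = (False, int i, 0)"
      using word_op_replicate [of D 1 0 i] by (simp add: v_def arc_op_def refl_arc_def)
    show "word_op w = (False, 0, int j)"
      unfolding w_def by (induction j) (simp_all add: arc_op_def refl_arc_def dmul_def zero_prod_def)
  qed
  have "fst ` set (u @ v @ w) \<subseteq> {Strand 0, Strand 1, D}"
    by (auto simp: u_def v_def w_def)
  also have "\<dots> \<subseteq> arcs graph"
    by (auto simp: arcs_graph)
  finally have "act (Gen s) (u @ v @ w) \<in> qterms (arcs graph)"
    using s by (intro act_qterms) (auto simp: arcs_graph)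
  moreover have "ev (Gen s) = (s, False, 0)"
    using s by (auto simp: zero_prod_def)
  then have "ev (act (Gen s) (u @ v @ w)) = (s, \<delta>, int i, int j)"
    by (simp add: ev_act word_op_append uvw dmul_def)
  ultimately show ?thesis
    by blast
qed

lemma card_carrier: "card (carrier Q) = 4 * k * m * n + 2 * k * m + 2 * k * n"
proof -
  let ?T = "qterms (arcs graph)"
  have "card (cls ` ?T) = card ((reduce \<circ> ev) ` ?T)"
    by (rule card_image_cong) (simp add: cls_eq_iff sim_iff_reduce)
  moreover have "(reduce \<circ> ev) ` ?T = normal_forms"
  proof
    show "(reduce \<circ> ev) ` ?T \<subseteq> normal_forms"
      using reduce_ev by auto
    show "normal_forms \<subseteq> (reduce \<circ> ev) ` ?T"
    proof
      fix y assume y: "y \<in> normal_forms"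
      obtain s \<delta> i j where sij: "y = (s, \<delta>, i, j)" by (cases y)
      then have "s \<in> {Strand 0, Strand 1, C, D, E, F}" "0 \<le> i" "0 \<le> j"
        using y by (auto simp: normal_forms_def)
      then obtain x where "x \<in> ?T" "ev x = y"
        using ex_ev [of s \<delta> "nat i" "nat j"] sij by auto
      then show "y \<in> (reduce \<circ> ev) ` ?T"
        using reduce_normal_form [OF y] by force
    qed
  qed
  ultimately show ?thesis
    by (simp add: carrier_presented card_normal_forms)
qed

end

theorem theorem5p1:
  fixes k m n :: nat
  assumes "k \<ge> 1" and "m \<ge> 1" and "n \<ge> 1"
  shows "card (carrier (fundamental_N_quandle (strut_twist_graph k) [2, 2, m, n, 2, 2]))
    = 4 * k * m * n + 2 * k * m + 2 * k * n"
proof -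
  interpret strut_twist k m n
    using assms by unfold_locales
  show ?thesis
    unfolding fundamental_N_quandle_eq by (rule card_carrier)
qed

end
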